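(* Let $(a_k),(b_k)$ be a Bregman alternating sequence between $A$ and $B$, with gap $(K^*,r^* )$. Suppose the $lr$-angle condition and the $lr$-three-point inequality are satisfied at every pair $(b^*,a^* )\in K^*$. Then the sequence $(a_k)$ (which satisfies $a_k\in\overrightarrow{P}_A\circ\overleftarrow{P}_B(a_{k-1})$) converges.
   Context: Setting: $f:\mathbb R^d\to\mathbb R\cup\{+\infty\}$ is a convex function of Legendre type (in Rockafellar's sense), $G:=\mathrm{int}(\mathrm{dom} f)$, $f$ is of class $C^2$ on $G$ and $\nabla^2f(x)\succ0$ for all $x\in G$. The Bregman distance is $D(x,y)=f(x)-f(y)-\langle\nabla f(y),x-y\rangle$ for $y\in G$ and $D(x,y)=+\infty$ otherwise. $A,B\subset G$ are nonempty, closed and bounded. Projections: $\overleftarrow{P}_B(a)=\mathrm{argmin}\{D(b',a):b'\in B\}$; $\overrightarrow{D}_A(b)=\min\{D(b,a'):a'\in A\}$, $\overrightarrow{P}_A(b)=\mathrm{argmin}\{D(b,a'):a'\in A\}$ (set-valued). A Bregman alternating sequence is $a_k\in A$, $b_k\in B$ with $b_k\in\overleftarrow{P}_B(a_k)$, $a_{k+1}\in\overrightarrow{P}_A(b_k)$ for all $k$. An $lr$-building block $a\to b\to a^+$ consists of $a\in A$, $b\in\overleftarrow{P}_B(a)$, $a^+\in\overrightarrow{P}_A(b)$. Gaps: for $b^*\in B$, $a^*\in A$ write $b^*\sim a^*$ (gap pair) if $a^*\in\overrightarrow{P}_A(b^* )$ and $b^*\in\overleftarrow{P}_B(a^* )$;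 its gap value is the $r^*\ge0$ with $D(b^*,a^* )=\frac12 r^{*2}$. For an alternating sequence, $D(b_k,a_k)$ decreases to a limit $\frac12r^{*2}$; with $A^*,B^*$ the sets of accumulation points of $(a_k)$, $(b_k)$, the gap of the sequence is $(K^*,r^* )$, $K^*=\{(b^*,a^* )\in B^*\times A^*: b^*\sim a^*\}$. De-singularizing function: a continuous concave $\phi:[0,\eta)\to\mathbb R_+$ with $\phi(0)=0$, $\phi$ of class $C^1$ on $(0,\eta)$, $\phi'>0$ on $(0,\eta)$. $lr$-angle condition at a gap pair $b^*\sim a^*$ with value $r^*$: there exist a neighborhood $W$ of $(b^*,a^* )$, constants $\gamma,\eta>0$ and a de-singularizing function $\phi:[0,\eta)\to\mathbb R_+$ such that $\sigma(s)=\phi'(s)^{-2}$ if $r^*>0$, respectively $\sigma(s)=\phi'(s)^{-2}s^{-1}$ if $r^*=0$, is nondecreasing and $$\frac{1-\cos\alpha}{\sigma(\overrightarrow{D}_A(b)-\frac12r^{*2})}\ge\gamma$$ for every $lr$-building block $a\to b\to a^+$ with $(b,a^+)\in W$ and $\frac12r^{*2}<\overrightarrow{D}_A(b)<\frac12r^{*2}+\eta$, where $\alpha$ is the angle between $\nabla f(a)-\nabla f(b)$ and $\nabla f(a^+)-\nabla f(b)$. $lr$-three-point inequality at $(b^*,a^* )$: there exist $\ell\in(0,1)$ and $\delta>0$ such that $D(b,a)\ge D(b,a^+)+\ell D(a^+,a)$ for every $lr$-building block $a\to b\to a^+$ with $\|b-b^*\|<\delta$, $\|a^+-a^*\|<\delta$.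 *)

theory Defs
  imports "HOL-Analysis.Analysis"
begin

text \<open>
  A function with values in \<open>\<real> \<union> {+\<infinity>}\<close> is an \<^typ>\<open>ereal\<close>-valued function that
  avoids \<open>-\<infinity>\<close>; this is part of \<open>convex_ext\<close> below.
\<close>

definition edom :: "('a \<Rightarrow> ereal) \<Rightarrow> 'a set" where
  "edom f = {x. f x < \<infinity>}"

definition int_dom :: "('a::topological_space \<Rightarrow> ereal) \<Rightarrow> 'a set" where
  "int_dom f = interior (edom f)"

definition convex_ext :: "('a::real_vector \<Rightarrow> ereal) \<Rightarrow> bool" where
  "convex_ext f \<longleftrightarrow> (\<forall>x. f x \<noteq> -\<infinity>) \<and> convex {(x, t::real). f x \<le> ereal t}"

abbreviation real_part :: "('a \<Rightarrow> ereal) \<Rightarrow> 'a \<Rightarrow> real" where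
  "real_part f \<equiv> (\<lambda>x. real_of_ereal (f x))"

definition strictly_convex_on :: "'a::real_vector set \<Rightarrow> ('a \<Rightarrow> real) \<Rightarrow> bool" where
  "strictly_convex_on S g \<longleftrightarrow> convex S \<and>
     (\<forall>x\<in>S. \<forall>y\<in>S. \<forall>t. x \<noteq> y \<longrightarrow> 0 < t \<longrightarrow> t < 1 \<longrightarrow>
        g ((1 - t) *\<^sub>R x + t *\<^sub>R y) < (1 - t) * g x + t * g y)"

definition grad :: "('a::real_inner \<Rightarrow> real) \<Rightarrow> 'a \<Rightarrow> 'a" where
  "grad g x = (THE v. GDERIV g x :> v)"

definition hessian :: "(real ^ 'n::finite \<Rightarrow> real) \<Rightarrow> real ^ 'n \<Rightarrow> real ^ 'n ^ 'n" where
  "hessian g x = jacobian (grad g) (at x)"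

text \<open>Intended for open \<open>S\<close>.\<close>

definition C2_on :: "(real ^ 'n::finite) set \<Rightarrow> (real ^ 'n \<Rightarrow> real) \<Rightarrow> bool" where
  "C2_on S g \<longleftrightarrow> (\<forall>x\<in>S. g differentiable (at x)) \<and>
     (\<forall>x\<in>S. grad g differentiable (at x)) \<and> continuous_on S (hessian g)"

text \<open>Symmetry is not required here: it is automatic for the Hessian of a \<open>C\<^sup>2\<close> function.\<close>

definition pos_definite :: "real ^ 'n ^ 'n::finite \<Rightarrow> bool" where
  "pos_definite M \<longleftrightarrow> (\<forall>v. v \<noteq> 0 \<longrightarrow> 0 < v \<bullet> (M *v v))"

text \<open>
  Rockafellar (Convex Analysis, Section 26): the pair \<open>(C, f)\<close> with \<open>C = int (dom f)\<close> is of
  Legendre type if \<open>C\<close> is nonempty, \<open>f\<close> is differentiable and strictly convex on \<open>C\<close>, and the norm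
  of the gradient tends to infinity along every sequence in \<open>C\<close> converging to a boundary
  point of \<open>C\<close>. Lower semicontinuity of \<open>f\<close> is not part of this definition.
\<close>

definition legendre_type :: "('a::euclidean_space \<Rightarrow> ereal) \<Rightarrow> bool" where
  "legendre_type f \<longleftrightarrow>
     int_dom f \<noteq> {} \<and>
     (\<forall>x\<in>int_dom f. real_part f differentiable (at x)) \<and>
     strictly_convex_on (int_dom f) (real_part f) \<and>
     (\<forall>x p. (\<forall>n. x n \<in> int_dom f) \<and> x \<longlonglongrightarrow> p \<and> p \<in> frontier (int_dom f) \<longrightarrow>
        filterlim (\<lambda>n. norm (grad (real_part f) (x n))) at_top sequentially)"

definition bregman :: "('a::real_inner \<Rightarrow> ereal) \<Rightarrow> 'a \<Rightarrow> 'a \<Rightarrow> ereal" where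
  "bregman f x y =
     (if y \<in> int_dom f then f x - f y - ereal (grad (real_part f) y \<bullet> (x - y)) else \<infinity>)"

definition left_proj :: "('a::real_inner \<Rightarrow> ereal) \<Rightarrow> 'a set \<Rightarrow> 'a \<Rightarrow> 'a set" where
  "left_proj f B a = {b. is_arg_min (\<lambda>b'. bregman f b' a) (\<lambda>b'. b' \<in> B) b}"

definition right_proj :: "('a::real_inner \<Rightarrow> ereal) \<Rightarrow> 'a set \<Rightarrow> 'a \<Rightarrow> 'a set" where
  "right_proj f A b = {a. is_arg_min (\<lambda>a'. bregman f b a') (\<lambda>a'. a' \<in> A) a}"

text \<open>The infimum is a minimum whenever \<open>right_proj f A b\<close> is nonempty.\<close>

definition right_dist :: "('a::real_inner \<Rightarrow> ereal) \<Rightarrow> 'a set \<Rightarrow> 'a \<Rightarrow> ereal" where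
  "right_dist f A b = (INF a'\<in>A. bregman f b a')"

definition bregman_alternating ::
  "('a::real_inner \<Rightarrow> ereal) \<Rightarrow> 'a set \<Rightarrow> 'a set \<Rightarrow> (nat \<Rightarrow> 'a) \<Rightarrow> (nat \<Rightarrow> 'a) \<Rightarrow> bool" where
  "bregman_alternating f A B a b \<longleftrightarrow>
     (\<forall>k. a k \<in> A \<and> b k \<in> B \<and> b k \<in> left_proj f B (a k) \<and> a (Suc k) \<in> right_proj f A (b k))"

definition lr_building_block ::
  "('a::real_inner \<Rightarrow> ereal) \<Rightarrow> 'a set \<Rightarrow> 'a set \<Rightarrow> 'a \<Rightarrow> 'a \<Rightarrow> 'a \<Rightarrow> bool" where
  "lr_building_block f A B a b a' \<longleftrightarrow>
     a \<in> A \<and> b \<in> left_proj f B a \<and> a' \<in> right_proj f A b"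

definition gap_pair ::
  "('a::real_inner \<Rightarrow> ereal) \<Rightarrow> 'a set \<Rightarrow> 'a set \<Rightarrow> 'a \<Rightarrow> 'a \<Rightarrow> bool" where
  "gap_pair f A B bs as \<longleftrightarrow>
     bs \<in> B \<and> as \<in> A \<and> as \<in> right_proj f A bs \<and> bs \<in> left_proj f B as"

definition gap_value :: "('a::real_inner \<Rightarrow> ereal) \<Rightarrow> 'a \<Rightarrow> 'a \<Rightarrow> real" where
  "gap_value f bs as = (THE r. 0 \<le> r \<and> bregman f bs as = ereal (r\<^sup>2 / 2))"

definition accumulation_points :: "(nat \<Rightarrow> 'a::topological_space) \<Rightarrow> 'a set" where
  "accumulation_points x = {l. \<exists>s::nat \<Rightarrow> nat. strict_mono s \<and> (x \<circ> s) \<longlonglongrightarrow> l}"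

text \<open>
  \<open>(K, r)\<close> is the gap of the alternating sequence \<open>(a, b)\<close>. The limit exists for every
  alternating sequence, since \<open>bregman f (b k) (a k)\<close> is nonincreasing in \<open>k\<close>.
\<close>

definition sequence_gap ::
  "('a::real_inner \<Rightarrow> ereal) \<Rightarrow> 'a set \<Rightarrow> 'a set \<Rightarrow> (nat \<Rightarrow> 'a) \<Rightarrow> (nat \<Rightarrow> 'a) \<Rightarrow>
     ('a \<times> 'a) set \<Rightarrow> real \<Rightarrow> bool" where
  "sequence_gap f A B a b K r \<longleftrightarrow>
     0 \<le> r \<and> (\<lambda>k. bregman f (b k) (a k)) \<longlonglongrightarrow> ereal (r\<^sup>2 / 2) \<and>
     K = {(bs, as). bs \<in> accumulation_points b \<and> as \<in> accumulation_points a \<and>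
            gap_pair f A B bs as}"

definition desingularizing :: "real \<Rightarrow> (real \<Rightarrow> real) \<Rightarrow> bool" where
  "desingularizing \<eta> \<phi> \<longleftrightarrow>
     continuous_on {0..<\<eta>} \<phi> \<and> concave_on {0..<\<eta>} \<phi> \<and>
     (\<forall>s\<in>{0..<\<eta>}. 0 \<le> \<phi> s) \<and> \<phi> 0 = 0 \<and>
     (\<forall>s\<in>{0<..<\<eta>}. \<phi> differentiable (at s)) \<and> continuous_on {0<..<\<eta>} (deriv \<phi>) \<and>
     (\<forall>s\<in>{0<..<\<eta>}. 0 < deriv \<phi> s)"

definition angle_rate :: "real \<Rightarrow> (real \<Rightarrow> real) \<Rightarrow> real \<Rightarrow> real" where
  "angle_rate r \<phi> s =
     (if r > 0 then 1 / (deriv \<phi> s)\<^sup>2 else 1 / ((deriv \<phi> s)\<^sup>2 * s))"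

text \<open>
  The angle is \<open>pi / 2\<close> if one of the vectors vanishes. In the angle condition below both
  vectors are nonzero: \<open>grad (real_part f)\<close> is injective on \<open>int_dom f\<close>, and \<open>b \<in> {a, a'}\<close>
  would give \<open>right_dist f A b = 0\<close>.
\<close>

definition vector_angle :: "'a::real_inner \<Rightarrow> 'a \<Rightarrow> real" where
  "vector_angle u v = arccos ((u \<bullet> v) / (norm u * norm v))"

definition lr_angle_condition ::
  "('a::real_inner \<Rightarrow> ereal) \<Rightarrow> 'a set \<Rightarrow> 'a set \<Rightarrow> 'a \<Rightarrow> 'a \<Rightarrow> bool" where
  "lr_angle_condition f A B bs as \<longleftrightarrow>
     (\<exists>W \<gamma> \<eta> \<phi>. open W \<and> (bs, as) \<in> W \<and> 0 < \<gamma> \<and> 0 < \<eta> \<and> desingularizing \<eta> \<phi> \<and>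
        mono_on {0<..<\<eta>} (angle_rate (gap_value f bs as) \<phi>) \<and>
        (\<forall>a b a'. lr_building_block f A B a b a' \<longrightarrow> (b, a') \<in> W \<longrightarrow>
           ereal ((gap_value f bs as)\<^sup>2 / 2) < right_dist f A b \<longrightarrow>
           right_dist f A b < ereal ((gap_value f bs as)\<^sup>2 / 2 + \<eta>) \<longrightarrow>
           (1 - cos (vector_angle (grad (real_part f) a - grad (real_part f) b)
                                  (grad (real_part f) a' - grad (real_part f) b)))
             / angle_rate (gap_value f bs as) \<phi>
                 (real_of_ereal (right_dist f A b) - (gap_value f bs as)\<^sup>2 / 2) \<ge> \<gamma>))"

definition lr_three_point ::
  "('a::real_inner \<Rightarrow> ereal) \<Rightarrow> 'a set \<Rightarrow> 'a set \<Rightarrow> 'a \<Rightarrow> 'a \<Rightarrow> bool" where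
  "lr_three_point f A B bs as \<longleftrightarrow>
     (\<exists>l \<delta>. 0 < l \<and> l < 1 \<and> 0 < \<delta> \<and>
        (\<forall>a b a'. lr_building_block f A B a b a' \<longrightarrow> norm (b - bs) < \<delta> \<longrightarrow> norm (a' - as) < \<delta> \<longrightarrow>
           bregman f b a \<ge> bregman f b a' + ereal l * bregman f a' a))"

end

(*
  With u = grad f(a) - grad f(b) and v = grad f(a+) - grad f(b) one has
  2 |u| |v| (1 - cos alpha) <= |u - v|^2. On the compact convex hull of A and B the gradient is
  Lipschitz and strongly monotone, so |u| |v| is at least a multiple of D(b,a+) and the angle
  condition becomes a Kurdyka-Lojasiewicz inequality phi'(S_k) |a_{k+1} - a_k| >= c for the
  excess S_k = D(b_k,a_{k+1}) - r^2/2. The three-point inequality gives the sufficient decrease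
  S_k - S_{k+1} >= c' |a_{k+2} - a_{k+1}|^2, and concavity of phi yields
  |a_{k+2} - a_{k+1}|^2 <= C |a_{k+1} - a_k| (phi(S_k) - phi(S_{k+1})), hence finite length.
  Every cluster point of (b_k,a_{k+1}) is a gap pair in K^*, so finitely many of the
  neighbourhoods cover the tail of the sequence, and the corresponding functions phi are added up.
*)
theory Submission
  imports Defs
begin

section \<open>Gradients, cluster points, summable steps and angles\<close>

text \<open>\<open>grad\<close> is a definite description, so existence and uniqueness are both due:
  the Riesz vector of the derivative is read off on \<open>Basis\<close>, and the derivative is
  unique.\<close>

lemma grad_GDERIV:
  fixes g :: "'a::euclidean_space \<Rightarrow> real"
  assumes "g differentiable (at x)"
  shows "GDERIV g x :> grad g x"
proof -
  obtain D where D: "(g has_derivative D) (at x)"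
    using assms by (auto simp: differentiable_def)
  then interpret bounded_linear D
    by (rule has_derivative_bounded_linear)
  let ?v = "\<Sum>i\<in>Basis. D i *\<^sub>R i"
  have "D h = h \<bullet> ?v" for h
  proof -
    have "D h = D (\<Sum>i\<in>Basis. (h \<bullet> i) *\<^sub>R i)"
      by (simp add: euclidean_representation)
    then show ?thesis
      by (simp add: sum scaleR inner_sum_right mult.commute)
  qed
  then have v: "GDERIV g x :> ?v"
    using D unfolding gderiv_def by (metis (no_types, lifting) ext)
  moreover have "w = ?v" if "GDERIV g x :> w" for w
  proof -
    have "(\<lambda>h. h \<bullet> w) = (\<lambda>h. h \<bullet> ?v)"
      using that v unfolding gderiv_def by (rule has_derivative_unique)
    then show ?thesis
      by (metis vector_eq_ldot)
  qed
  ultimately show ?thesis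
    unfolding grad_def by (rule theI)
qed

text \<open>Prepares the covering argument: the local hypotheses are available at cluster points
  only, whereas a neighbourhood that the tail avoids imposes nothing on the tail.\<close>

lemma cluster_point_or_avoiding_nhd:
  fixes z :: "nat \<Rightarrow> 'a::metric_space"
  obtains s where "strict_mono s" "(z \<circ> s) \<longlonglongrightarrow> p"
  | W where "open W" "p \<in> W" "\<forall>\<^sub>F k in sequentially. z k \<notin> W"
proof (cases "\<exists>e>0. \<forall>\<^sub>F k in sequentially. z k \<notin> ball p e")
  case True
  then show ?thesis
    using that(2) by (metis centre_in_ball open_ball)
next
  case False
  then have fr: "\<exists>k>N. dist (z k) p < e" if "e > 0" for e N
    using that unfolding eventually_sequentially
    by (metis Suc_le_lessD dist_commute mem_ball)
  have "\<exists>s. \<forall>n. dist (z (s n)) p < 1 / Suc n \<and> s n < s (Suc n)"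
  proof (rule dependent_nat_choice)
    show "\<exists>x. dist (z x) p < 1 / Suc 0"
      using fr[of 1] by auto
    show "\<exists>y. dist (z y) p < 1 / Suc (Suc n) \<and> x < y" for x n
      using fr[of "1 / Suc (Suc n)" x] by auto
  qed
  then obtain s where s: "\<And>n. dist (z (s n)) p < 1 / Suc n" "\<And>n. s n < s (Suc n)"
    by blast
  have "(\<lambda>n. dist (z (s n)) p) \<longlonglongrightarrow> 0"
    by (rule Lim_null_comparison[OF _ LIMSEQ_inverse_real_of_nat])
      (use s(1) in \<open>auto simp: inverse_eq_divide intro: less_imp_le always_eventually\<close>)
  then have "(z \<circ> s) \<longlonglongrightarrow> p"
    unfolding tendsto_dist_iff[of "z \<circ> s"] by (simp add: o_def)
  moreover have "strict_mono s"
    using s(2) by (simp add: strict_mono_Suc_iff)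
  ultimately show ?thesis
    by (intro that(1))
qed

lemma convergent_if_summable_diffs:
  fixes a :: "nat \<Rightarrow> 'a::banach"
  assumes "summable (\<lambda>k. norm (a (Suc k) - a k))"
  shows "convergent a"
proof -
  have "summable (\<lambda>k. a (Suc k) - a k)"
    using assms by (rule summable_norm_cancel)
  then have "convergent (\<lambda>n. \<Sum>k<n. a (Suc k) - a k)"
    by (simp add: summable_iff_convergent)
  then have "convergent (\<lambda>n. (\<Sum>k<n. a (Suc k) - a k) + a 0)"
    by (intro convergent_add convergent_const)
  then show ?thesis
    by (simp add: sum_lessThan_telescope)
qed

text \<open>By the arithmetic-geometric mean inequality, \<open>rec\<close> gives
  \<open>2 * x (Suc k) \<le> x k + C * (\<Phi> k - \<Phi> (Suc k))\<close>. Moving one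
  \<open>x (Suc k)\<close> across bounds it by the drop of the nonnegative potential
  \<open>V k = x k + C * \<Phi> k\<close>, and these drops telescope.\<close>

lemma summable_from_KL_recursion:
  fixes x \<Phi> :: "nat \<Rightarrow> real"
  assumes "0 \<le> C"
    and rec: "\<And>k. N \<le> k \<Longrightarrow> (x (Suc k))\<^sup>2 \<le> C * x k * (\<Phi> k - \<Phi> (Suc k))"
    and x: "\<And>k. 0 \<le> x k"
    and \<Phi>: "\<And>k. N \<le> k \<Longrightarrow> 0 \<le> \<Phi> k" "\<And>k. N \<le> k \<Longrightarrow> \<Phi> (Suc k) \<le> \<Phi> k"
  shows "summable x"
proof -
  define V where "V k = x k + C * \<Phi> k" for k
  have step: "x (Suc k) \<le> V k - V (Suc k)" if "N \<le> k" for k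
  proof -
    define t where "t = C * (\<Phi> k - \<Phi> (Suc k))"
    have t: "0 \<le> t"
      using assms(1) \<Phi>(2)[OF that] by (simp add: t_def)
    have "(2 * x (Suc k))\<^sup>2 \<le> 4 * (x k * t)"
      using mult_left_mono[OF rec[OF that], of 4] by (simp add: t_def power_mult_distrib mult_ac)
    also have "\<dots> \<le> (x k + t)\<^sup>2"
      using zero_le_power2[of "x k - t"] by (simp add: power2_eq_square algebra_simps)
    finally have "(2 * x (Suc k))\<^sup>2 \<le> (x k + t)\<^sup>2" .
    then have "2 * x (Suc k) \<le> x k + t"
      by (rule power2_le_imp_le) (simp add: t x)
    then show ?thesis
      by (simp add: V_def t_def algebra_simps)
  qed
  have V: "0 \<le> V k" if "N \<le> k" for k
    using that x[of k] \<Phi>(1) assms(1) by (simp add: V_def)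
  have "(\<Sum>k<n. x (Suc k + N)) \<le> V N" for n
  proof -
    have "(\<Sum>k<n. x (Suc k + N)) \<le> V N - V (n + N)"
    proof (induction n)
      case (Suc n)
      then show ?case
        using step[of "n + N"] by simp
    qed simp
    then show ?thesis
      using V[of "n + N"] by simp
  qed
  then have "summable (\<lambda>k. x (Suc k + N))"
    using x by (intro summableI_nonneg_bounded[where x = "V N"]) auto
  then have "summable (\<lambda>k. x (k + Suc N))"
    by simp
  then show ?thesis
    by (rule summable_iff_shift[THEN iffD1])
qed

text \<open>Law of cosines together with \<open>0 \<le> (norm u - norm v)\<^sup>2\<close>. If a
  vector vanishes, so does the left side, whatever value the angle then takes.\<close>

lemma two_norm_mult_one_minus_cos_le:
  fixes u v :: "'a::real_inner"
  shows "2 * (norm u * norm v) * (1 - cos (vector_angle u v)) \<le> (norm (u - v))\<^sup>2"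
proof (cases "u = 0 \<or> v = 0")
  case False
  then have pos: "0 < norm u * norm v"
    by simp
  have "\<bar>(u \<bullet> v) / (norm u * norm v)\<bar> \<le> 1"
    using Cauchy_Schwarz_ineq2[of u v] pos by (simp add: divide_le_eq)
  then have "cos (vector_angle u v) = (u \<bullet> v) / (norm u * norm v)"
    by (simp add: vector_angle_def cos_arccos_abs)
  then have "2 * (norm u * norm v) * (1 - cos (vector_angle u v)) = 2 * (norm u * norm v) - 2 * (u \<bullet> v)"
    using pos by (simp add: field_simps)
  also have "\<dots> \<le> (norm (u - v))\<^sup>2"
    using zero_le_power2[of "norm u - norm v"]
    by (simp add: dot_norm_neg power2_eq_square field_simps)
  finally show ?thesis .
qed auto

section \<open>Real Bregman distances and gradient estimates for C^2 functions\<close>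

text \<open>Keeps the estimates free of \<open>ereal\<close> arithmetic;
  \<open>bregman_eq_breg\<close> is the bridge on the interior of the domain.\<close>

definition breg :: "('a::real_inner \<Rightarrow> real) \<Rightarrow> 'a \<Rightarrow> 'a \<Rightarrow> real" where
  "breg g x y = g x - g y - grad g y \<bullet> (x - y)"

lemma breg_add_breg: "breg g x y + breg g y x = (grad g x - grad g y) \<bullet> (x - y)"
  by (simp add: breg_def inner_diff algebra_simps)

lemma bregman_eq_breg:
  assumes "\<And>x. f x \<noteq> -\<infinity>" "x \<in> int_dom f" "y \<in> int_dom f"
  shows "bregman f x y = ereal (breg (real_part f) x y)"
proof -
  have fin: "\<exists>u. f z = ereal u" if "z \<in> int_dom f" for z
    using that assms(1)[of z] interior_subset[of "edom f"]
    by (cases "f z") (auto simp: int_dom_def edom_def)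
  obtain u w where "f x = ereal u" "f y = ereal w"
    using fin assms(2,3) by blast
  then show ?thesis
    using assms(3) by (simp add: bregman_def breg_def)
qed

lemma continuous_on_matrix_vector_mult_Times:
  fixes H :: "real ^ 'n::finite \<Rightarrow> real ^ 'n ^ 'n"
  assumes "continuous_on Q H"
  shows "continuous_on (Q \<times> S) (\<lambda>p. H (fst p) *v snd p)"
proof -
  have "continuous_on (Q \<times> S) (\<lambda>p. H (fst p))"
    using assms by (intro continuous_on_compose2[OF assms] continuous_intros) auto
  then show ?thesis
    unfolding matrix_vector_mult_def
    by (intro continuous_intros continuous_on_vec_lambda)
qed

lemma C2_grad_has_derivative:
  assumes "C2_on G g" "x \<in> G"
  shows "(grad g has_derivative (\<lambda>h. hessian g x *v h)) (at x)"
  using assms unfolding C2_on_def hessian_def by (simp add: jacobian_works)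

text \<open>Compactness of \<open>Q\<close> times the unit ball bounds the Hessian on unit vectors,
  homogeneity turns this into an operator norm bound, and the mean value inequality on the convex
  set \<open>Q\<close> gives the Lipschitz constant.\<close>

lemma C2_grad_Lipschitz_on_compact:
  fixes g :: "real ^ 'n::finite \<Rightarrow> real"
  assumes C2: "C2_on G g" and Q: "compact Q" "convex Q" "Q \<subseteq> G"
  obtains L where "0 < L"
    "\<And>x y. x \<in> Q \<Longrightarrow> y \<in> Q \<Longrightarrow> norm (grad g x - grad g y) \<le> L * norm (x - y)"
proof -
  have "continuous_on Q (hessian g)"
    using C2 Q(3) by (auto simp: C2_on_def intro: continuous_on_subset)
  then have "compact ((\<lambda>p. hessian g (fst p) *v snd p) ` (Q \<times> cball 0 1))"
    using Q(1) by (intro compact_continuous_image continuous_on_matrix_vector_mult_Times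
        compact_Times) auto
  then obtain L where L: "0 < L"
    and bound: "\<And>x v. x \<in> Q \<Longrightarrow> norm v \<le> 1 \<Longrightarrow> norm (hessian g x *v v) \<le> L"
    using bounded_pos[of "(\<lambda>p. hessian g (fst p) *v snd p) ` (Q \<times> cball 0 1)"]
    by (fastforce dest: compact_imp_bounded)
  have "norm (hessian g x *v v) \<le> L * norm v" if "x \<in> Q" for x v
  proof (cases "v = 0")
    case False
    then have "norm (hessian g x *v (v /\<^sub>R norm v)) \<le> L"
      using that by (intro bound) auto
    then show ?thesis
      using False by (simp add: matrix_vector_mult_scaleR divide_inverse_commute[symmetric] pos_divide_le_eq)
  qed auto
  then have "onorm ((*v) (hessian g x)) \<le> L" if "x \<in> Q" for x
    using that by (intro onorm_le) auto
  moreover have "(grad g has_derivative (*v) (hessian g x)) (at x within Q)" if "x \<in> Q" for x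
    using C2_grad_has_derivative[OF C2, of x] that Q(3) by (blast intro: has_derivative_at_withinI)
  ultimately have "norm (grad g x - grad g y) \<le> L * norm (x - y)" if "x \<in> Q" "y \<in> Q" for x y
    using Q(2) that by (intro differentiable_bound[where f' = "\<lambda>x. (*v) (hessian g x)" and S = Q]) auto
  with L show ?thesis
    by (rule that)
qed

lemma segment_in_convex:
  assumes "convex Q" "x \<in> Q" "y \<in> Q" "0 \<le> t" "t \<le> 1"
  shows "y + t *\<^sub>R (x - y) \<in> Q"
proof -
  have "y + t *\<^sub>R (x - y) = (1 - t) *\<^sub>R y + t *\<^sub>R x"
    by (simp add: algebra_simps)
  then show ?thesis
    using convexD_alt[OF assms(1) assms(3,2,4,5)] by simp
qed

text \<open>The quadratic form attains a positive minimum on the compact product of \<open>Q\<close>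
  with the unit sphere; quadratic homogeneity extends the bound to all vectors.\<close>

lemma hessian_uniformly_positive_on_compact:
  fixes g :: "real ^ 'n::finite \<Rightarrow> real"
  assumes C2: "C2_on G g" and pd: "\<And>x. x \<in> G \<Longrightarrow> pos_definite (hessian g x)"
    and Q: "compact Q" "Q \<subseteq> G"
  obtains m where "0 < m" "\<And>x v. x \<in> Q \<Longrightarrow> m * (norm v)\<^sup>2 \<le> v \<bullet> (hessian g x *v v)"
proof (cases "Q = {}")
  case True
  then show ?thesis
    using that[of 1] by auto
next
  case False
  let ?S = "Q \<times> sphere (0 :: real ^ 'n) 1"
  have "continuous_on Q (hessian g)"
    using C2 Q(2) by (auto simp: C2_on_def intro: continuous_on_subset)
  then have "continuous_on ?S (\<lambda>p. snd p \<bullet> (hessian g (fst p) *v snd p))"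
    by (intro continuous_intros continuous_on_matrix_vector_mult_Times)
  moreover have "compact ?S"
    using Q(1) by (simp add: compact_Times)
  moreover have "?S \<noteq> {}"
    using False by simp
  ultimately obtain p where p: "p \<in> ?S" and
    inf: "\<And>q. q \<in> ?S \<Longrightarrow> snd p \<bullet> (hessian g (fst p) *v snd p) \<le> snd q \<bullet> (hessian g (fst q) *v snd q)"
    by (metis (no_types, lifting) continuous_attains_inf)
  let ?m = "snd p \<bullet> (hessian g (fst p) *v snd p)"
  show ?thesis
  proof (rule that[of ?m])
    have "snd p \<noteq> 0" "fst p \<in> G"
      using p Q(2) by auto
    then show "0 < ?m"
      using pd unfolding pos_definite_def by blast
    show "?m * (norm v)\<^sup>2 \<le> v \<bullet> (hessian g x *v v)" if "x \<in> Q" for x v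
    proof (cases "v = 0")
      case False
      then show ?thesis
        using that inf[of "(x, v /\<^sub>R norm v)"]
        by (simp add: matrix_vector_mult_scaleR power2_eq_square field_simps)
    qed auto
  qed
qed

lemma C2_grad_strongly_monotone:
  fixes g :: "real ^ 'n::finite \<Rightarrow> real"
  assumes C2: "C2_on G g" and Q: "convex Q" "Q \<subseteq> G"
    and m: "\<And>x v. x \<in> Q \<Longrightarrow> m * (norm v)\<^sup>2 \<le> v \<bullet> (hessian g x *v v)"
    and xy: "x \<in> Q" "y \<in> Q"
  shows "m * (norm (x - y))\<^sup>2 \<le> (grad g x - grad g y) \<bullet> (x - y)"
proof -
  define c where "c t = y + t *\<^sub>R (x - y)" for t
  \<comment> \<open>The subtracted linear term has as its slope the lower bound of the Hessian form
    along the segment, so \<open>h\<close> is nondecreasing, and \<open>h 0 \<le> h 1\<close> is the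
    claim.\<close>
  define h where "h t = grad g (c t) \<bullet> (x - y) - m * (norm (x - y))\<^sup>2 * t" for t
  have "h 0 \<le> h 1"
  proof (rule DERIV_nonneg_imp_nondecreasing[where f = h])
    fix t :: real assume t: "0 \<le> t" "t \<le> 1"
    then have ct: "c t \<in> Q"
      using segment_in_convex[OF Q(1) xy] by (simp add: c_def)
    have dc: "(c has_derivative (\<lambda>s. s *\<^sub>R (x - y))) (at t)"
      unfolding c_def by (auto intro!: derivative_eq_intros)
    have "((\<lambda>t. grad g (c t)) has_derivative (\<lambda>s. hessian g (c t) *v (s *\<^sub>R (x - y)))) (at t)"
      using ct Q(2) by (intro has_derivative_compose[OF dc] C2_grad_has_derivative[OF C2]) auto
    then have "(h has_derivative (\<lambda>s. (hessian g (c t) *v (s *\<^sub>R (x - y))) \<bullet> (x - y)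
        - m * (norm (x - y))\<^sup>2 * s)) (at t)"
      unfolding h_def by (auto intro!: derivative_eq_intros)
    then have "(h has_field_derivative
        ((x - y) \<bullet> (hessian g (c t) *v (x - y)) - m * (norm (x - y))\<^sup>2)) (at t)"
      unfolding has_field_derivative_def
      by (rule has_derivative_eq_rhs)
        (auto simp: fun_eq_iff matrix_vector_mult_scaleR inner_commute algebra_simps)
    then show "\<exists>d. (h has_field_derivative d) (at t) \<and> 0 \<le> d"
      using m[OF ct, of "x - y"] by auto
  qed simp
  then show ?thesis
    by (simp add: h_def c_def inner_diff_left)
qed

text \<open>Integrates strong monotonicity once more along the segment; the factor
  \<open>m / 2\<close> is the integral of \<open>m * t\<close> over the unit interval.\<close>

lemma breg_ge_of_strongly_monotone:
  fixes g :: "'a::euclidean_space \<Rightarrow> real"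
  assumes diff: "\<And>x. x \<in> Q \<Longrightarrow> g differentiable (at x)" and Q: "convex Q"
    and m: "\<And>x y. x \<in> Q \<Longrightarrow> y \<in> Q \<Longrightarrow>
      m * (norm (x - y))\<^sup>2 \<le> (grad g x - grad g y) \<bullet> (x - y)"
    and xy: "x \<in> Q" "y \<in> Q"
  shows "m / 2 * (norm (x - y))\<^sup>2 \<le> breg g x y"
proof -
  define c where "c t = y + t *\<^sub>R (x - y)" for t
  define h where "h t = g (c t) - t * (grad g y \<bullet> (x - y)) - m / 2 * (norm (x - y))\<^sup>2 * t\<^sup>2" for t
  have "h 0 \<le> h 1"
  proof (rule DERIV_nonneg_imp_nondecreasing[where f = h])
    fix t :: real assume t: "0 \<le> t" "t \<le> 1"
    then have ct: "c t \<in> Q"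
      using segment_in_convex[OF Q xy] by (simp add: c_def)
    have dc: "(c has_derivative (\<lambda>s. s *\<^sub>R (x - y))) (at t)"
      unfolding c_def by (auto intro!: derivative_eq_intros)
    have "((\<lambda>t. g (c t)) has_derivative (\<lambda>s. (s *\<^sub>R (x - y)) \<bullet> grad g (c t))) (at t)"
      using grad_GDERIV[OF diff[OF ct]] unfolding gderiv_def
      by (rule has_derivative_compose[OF dc])
    then have "((\<lambda>t. g (c t)) has_field_derivative (grad g (c t) \<bullet> (x - y))) (at t)"
      unfolding has_field_derivative_def
      by (rule has_derivative_eq_rhs) (auto simp: fun_eq_iff inner_commute)
    then have dh: "(h has_field_derivative
        ((grad g (c t) - grad g y) \<bullet> (x - y) - m * (norm (x - y))\<^sup>2 * t)) (at t)"
      unfolding h_def by (auto intro!: derivative_eq_intros simp: inner_diff_left)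
    \<comment> \<open>Monotonicity between \<open>c t\<close> and \<open>y\<close>, which differ by
      \<open>t *\<^sub>R (x - y)\<close>, gives the slope bound with an extra factor
      \<open>t\<close>. This factor cancels for positive \<open>t\<close>; at \<open>t = 0\<close>
      both sides vanish.\<close>
    have "t * (m * (norm (x - y))\<^sup>2 * t) \<le> t * ((grad g (c t) - grad g y) \<bullet> (x - y))"
      using m[OF ct xy(2)] by (simp add: c_def power_mult_distrib power2_eq_square mult_ac)
    then have "m * (norm (x - y))\<^sup>2 * t \<le> (grad g (c t) - grad g y) \<bullet> (x - y)"
      using t by (cases "t = 0") (auto simp: c_def)
    then show "\<exists>d. (h has_field_derivative d) (at t) \<and> 0 \<le> d"
      using dh by auto
  qed simp
  then show ?thesis
    by (simp add: h_def c_def breg_def)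
qed

lemma continuous_on_breg:
  assumes "C2_on G g"
  shows "continuous_on (G \<times> G) (\<lambda>p. breg g (fst p) (snd p))"
proof -
  have "continuous_on G g" "continuous_on G (grad g)"
    using assms by (auto simp: C2_on_def intro!: continuous_at_imp_continuous_on
        differentiable_imp_continuous_within)
  then have "continuous_on (G \<times> G) (\<lambda>p. g (fst p))" "continuous_on (G \<times> G) (\<lambda>p. g (snd p))"
    "continuous_on (G \<times> G) (\<lambda>p. grad g (snd p))"
    by (auto elim!: continuous_on_compose2 intro!: continuous_intros)
  then show ?thesis
    unfolding breg_def by (intro continuous_intros)
qed

section \<open>De-singularizing functions and gap values\<close>

text \<open>A concave graph lies below its tangents. The point of tangency must be interior, but
  \<open>t = 0\<close> is allowed, which covers an excess that drops to zero in one step.\<close>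

lemma desingularizing_tangent:
  assumes des: "desingularizing \<eta> \<phi>" and s: "0 < s" "s < \<eta>" and t: "0 \<le> t" "t < \<eta>"
  shows "deriv \<phi> s * (s - t) \<le> \<phi> s - \<phi> t"
proof -
  have "(\<phi> has_field_derivative deriv \<phi> s) (at s)"
    using des s by (simp add: desingularizing_def DERIV_deriv_iff_real_differentiable)
  then have "((\<lambda>x. - \<phi> x) has_field_derivative - deriv \<phi> s) (at s within {0..<\<eta>})"
    by (rule has_field_derivative_at_within[OF DERIV_minus])
  moreover have "convex_on {0..<\<eta>} (\<lambda>x. - \<phi> x)"
    using des by (simp add: desingularizing_def concave_on_def)
  moreover have "s \<in> interior {0..<\<eta>}" "t \<in> {0..<\<eta>}"
    using s t by auto
  ultimately have "- deriv \<phi> s * (t - s) \<le> - \<phi> t - - \<phi> s"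
    by (intro convex_on_imp_above_tangent[where A = "{0..<\<eta>}"]) auto
  then show ?thesis
    by (simp add: algebra_simps)
qed

lemma desingularizing_mono:
  assumes des: "desingularizing \<eta> \<phi>" and "0 \<le> t" "t \<le> s" "s < \<eta>"
  shows "\<phi> t \<le> \<phi> s"
proof (cases "s = 0")
  case False
  then have "0 \<le> deriv \<phi> s * (s - t)"
    using assms by (intro mult_nonneg_nonneg) (auto simp: desingularizing_def intro: less_imp_le)
  then show ?thesis
    using desingularizing_tangent[OF des, of s t] assms False by linarith
qed (use assms in auto)

lemma gap_value_eqI:
  assumes "bregman f bs as = ereal (r\<^sup>2 / 2)" "0 \<le> r"
  shows "gap_value f bs as = r"
  unfolding gap_value_def using assms by (intro the_equality) auto

section \<open>The alternating sequence under uniform gradient bounds\<close>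

text \<open>Collects what the argument draws from \<open>f\<close>: real distances, constants
  \<open>L\<close> and \<open>m\<close> for the gradient, and continuity, all on the union of
  \<open>A\<close> and \<open>B\<close>. Hessians and the convex hull enter only when these facts
  are established.\<close>

locale bregman_alternation =
  fixes f :: "'a::euclidean_space \<Rightarrow> ereal" and A B :: "'a set" and a b :: "nat \<Rightarrow> 'a"
    and r L m :: real
  assumes bregman_eq: "\<And>x y. x \<in> A \<union> B \<Longrightarrow> y \<in> A \<union> B \<Longrightarrow>
      bregman f x y = ereal (breg (real_part f) x y)"
    and compact_A: "compact A" and compact_B: "compact B"
    and L_pos: "0 < L" and m_pos: "0 < m"
    and Lipschitz: "\<And>x y. x \<in> A \<union> B \<Longrightarrow> y \<in> A \<union> B \<Longrightarrow>
      norm (grad (real_part f) x - grad (real_part f) y) \<le> L * norm (x - y)"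
    and monotone: "\<And>x y. x \<in> A \<union> B \<Longrightarrow> y \<in> A \<union> B \<Longrightarrow>
      m * (norm (x - y))\<^sup>2 \<le> (grad (real_part f) x - grad (real_part f) y) \<bullet> (x - y)"
    and breg_ge: "\<And>x y. x \<in> A \<union> B \<Longrightarrow> y \<in> A \<union> B \<Longrightarrow>
      m / 2 * (norm (x - y))\<^sup>2 \<le> breg (real_part f) x y"
    and breg_continuous: "continuous_on ((A \<union> B) \<times> (A \<union> B))
      (\<lambda>p. breg (real_part f) (fst p) (snd p))"
    and alternating: "bregman_alternating f A B a b"
    and r_nonneg: "0 \<le> r"
    and limit: "(\<lambda>k. breg (real_part f) (b k) (a k)) \<longlonglongrightarrow> r\<^sup>2 / 2"
begin

abbreviation d where "d \<equiv> breg (real_part f)"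
abbreviation gr where "gr \<equiv> grad (real_part f)"

lemma left_proj_iff:
  assumes "x \<in> A"
  shows "y \<in> left_proj f B x \<longleftrightarrow> y \<in> B \<and> (\<forall>y'\<in>B. d y x \<le> d y' x)"
  using assms by (auto simp: left_proj_def is_arg_min_def bregman_eq not_less)

lemma right_proj_iff:
  assumes "y \<in> B"
  shows "x \<in> right_proj f A y \<longleftrightarrow> x \<in> A \<and> (\<forall>x'\<in>A. d y x \<le> d y x')"
  using assms by (auto simp: right_proj_def is_arg_min_def bregman_eq not_less)

lemma right_dist_eq:
  assumes "y \<in> B" "x \<in> right_proj f A y"
  shows "right_dist f A y = ereal (d y x)"
proof -
  have "x \<in> A" "\<forall>x'\<in>A. d y x \<le> d y x'"
    using assms right_proj_iff by auto
  then show ?thesis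
    unfolding right_dist_def using assms(1)
    by (intro antisym INF_greatest) (auto intro!: INF_lower2[of x] simp: bregman_eq)
qed

lemma a_in [simp]: "a k \<in> A" and b_in [simp]: "b k \<in> B"
  and b_left_proj: "b k \<in> left_proj f B (a k)"
  and a_right_proj: "a (Suc k) \<in> right_proj f A (b k)"
  using alternating by (auto simp: bregman_alternating_def)

lemma building_block: "lr_building_block f A B (a k) (b k) (a (Suc k))"
  by (simp add: lr_building_block_def b_left_proj a_right_proj)

lemma b_minimal: "y \<in> B \<Longrightarrow> d (b k) (a k) \<le> d y (a k)"
  using b_left_proj[of k] left_proj_iff by auto

lemma a_minimal: "x \<in> A \<Longrightarrow> d (b k) (a (Suc k)) \<le> d (b k) x"
  using a_right_proj[of k] right_proj_iff by auto

lemma breg_nonneg: "x \<in> A \<union> B \<Longrightarrow> y \<in> A \<union> B \<Longrightarrow> 0 \<le> d x y"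
  using m_pos by (intro order_trans[OF _ breg_ge]) auto

text \<open>Strong monotonicity with Cauchy-Schwarz bounds \<open>m * norm (x - y)\<close> by the
  gradient difference. The symmetrised distance dominates \<open>d y x\<close> and is at most
  \<open>L * (norm (x - y))\<^sup>2\<close>; eliminating \<open>norm (x - y)\<close> leaves the
  factor \<open>m\<^sup>2 / L\<close>.\<close>

lemma breg_le_norm_grad_diff:
  assumes "x \<in> A \<union> B" "y \<in> A \<union> B"
  shows "m\<^sup>2 / L * d y x \<le> (norm (gr x - gr y))\<^sup>2"
proof -
  define n where "n = norm (gr x - gr y)"
  have "(gr x - gr y) \<bullet> (x - y) \<le> n * norm (x - y)"
    by (simp add: n_def norm_cauchy_schwarz)
  then have mn: "m * norm (x - y) \<le> n"
    using monotone[OF assms] m_pos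
    by (cases "x = y") (auto simp: n_def power2_eq_square mult.assoc[symmetric]
        dest: order_trans[rotated])
  have "d y x \<le> (gr x - gr y) \<bullet> (x - y)"
    using breg_add_breg[of "real_part f" x y] breg_nonneg[OF assms] by simp
  also have "\<dots> \<le> n * norm (x - y)"
    by (simp add: n_def norm_cauchy_schwarz)
  also have "\<dots> \<le> (L * norm (x - y)) * norm (x - y)"
    using Lipschitz[OF assms] by (intro mult_right_mono) (auto simp: n_def)
  finally have "m\<^sup>2 * d y x \<le> m\<^sup>2 * ((L * norm (x - y)) * norm (x - y))"
    by (intro mult_left_mono) auto
  also have "\<dots> = L * (m * norm (x - y))\<^sup>2"
    by (simp add: power2_eq_square mult_ac)
  also have "\<dots> \<le> L * n\<^sup>2"
    using mn L_pos m_pos by (intro mult_left_mono power_mono) auto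
  finally show ?thesis
    using L_pos by (simp add: n_def divide_le_eq mult.commute)
qed

text \<open>Both gradient differences have squared norm at least
  \<open>m\<^sup>2 / L * d y z\<close>, the one at \<open>x\<close> thanks to \<open>le\<close>, so
  this also bounds the product of their norms from below. Their mutual difference is
  \<open>gr x - gr z\<close>, of norm at most \<open>L * norm (z - x)\<close>. Hence one factor
  \<open>1 / L\<close> from the norms and two from the Lipschitz bound.\<close>

lemma angle_step_bound:
  assumes y: "y \<in> B" and x: "x \<in> A" and z: "z \<in> A" and le: "d y z \<le> d y x"
    and "0 < s" and angle: "\<gamma> \<le> (1 - cos (vector_angle (gr x - gr y) (gr z - gr y))) / s" "0 \<le> \<gamma>"
  shows "2 * m\<^sup>2 * \<gamma> / L ^ 3 * (s * d y z) \<le> (norm (z - x))\<^sup>2"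
proof -
  define u v where "u = gr x - gr y" and "v = gr z - gr y"
  have d: "0 \<le> d y z"
    using y z by (intro breg_nonneg) auto
  have "m\<^sup>2 / L * d y z \<le> m\<^sup>2 / L * d y x"
    using le L_pos by (intro mult_left_mono) auto
  then have u: "m\<^sup>2 / L * d y z \<le> (norm u)\<^sup>2"
    using breg_le_norm_grad_diff[of x y] x y by (simp add: u_def)
  have v: "m\<^sup>2 / L * d y z \<le> (norm v)\<^sup>2"
    using breg_le_norm_grad_diff[of z y] y z by (simp add: v_def)
  have "(m\<^sup>2 / L * d y z)\<^sup>2 \<le> (norm u)\<^sup>2 * (norm v)\<^sup>2"
    using u v d L_pos unfolding power2_eq_square[of "m\<^sup>2 / L * d y z"]
    by (intro mult_mono) auto
  then have uv: "m\<^sup>2 / L * d y z \<le> norm u * norm v"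
    by (intro power2_le_imp_le[of "m\<^sup>2 / L * d y z"]) (auto simp: power_mult_distrib)
  have "\<gamma> * s \<le> 1 - cos (vector_angle u v)"
    using angle(1) \<open>0 < s\<close> by (simp add: u_def v_def pos_le_divide_eq)
  then have "(2 * (m\<^sup>2 / L * d y z)) * (\<gamma> * s) \<le> (2 * (norm u * norm v)) * (1 - cos (vector_angle u v))"
    using uv \<open>0 \<le> \<gamma>\<close> \<open>0 < s\<close> d L_pos
    by (intro mult_mono[OF mult_left_mono[OF uv]]) auto
  also have "\<dots> \<le> (norm (u - v))\<^sup>2"
    by (rule two_norm_mult_one_minus_cos_le)
  also have "\<dots> \<le> (L * norm (z - x))\<^sup>2"
    using Lipschitz[of x z] x z by (intro power_mono) (auto simp: u_def v_def norm_minus_commute)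
  finally show ?thesis
    using L_pos by (simp add: field_simps power2_eq_square power3_eq_cube)
qed

section \<open>The excess over the limit distance, and cluster points\<close>

text \<open>The excess is taken at the half-step because \<open>d (b k) (a (Suc k))\<close> is the
  value of \<open>right_dist f A (b k)\<close>, the argument of the angle condition.\<close>

definition S where "S k = d (b k) (a (Suc k)) - r\<^sup>2 / 2"

lemma breg_step_le: "d (b (Suc k)) (a (Suc k)) \<le> d (b k) (a (Suc k))"
  by (intro b_minimal) auto

lemma S_le: "S k \<le> d (b k) (a k) - r\<^sup>2 / 2"
  using a_minimal[of "a k" k] by (simp add: S_def)

lemma S_ge: "d (b (Suc k)) (a (Suc k)) - r\<^sup>2 / 2 \<le> S k"
  using breg_step_le[of k] by (simp add: S_def)

lemma S_Suc_le: "S (Suc k) \<le> S k"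
  using S_le[of "Suc k"] S_ge[of k] by linarith

text \<open>The half-step distances lie between consecutive terms of the sequence in
  \<open>limit\<close>.\<close>

lemma S_tendsto: "S \<longlonglongrightarrow> 0"
proof (rule tendsto_sandwich[OF always_eventually always_eventually])
  show "\<forall>k. d (b (Suc k)) (a (Suc k)) - r\<^sup>2 / 2 \<le> S k" "\<forall>k. S k \<le> d (b k) (a k) - r\<^sup>2 / 2"
    using S_ge S_le by auto
  show lim0: "(\<lambda>k. d (b k) (a k) - r\<^sup>2 / 2) \<longlonglongrightarrow> 0"
    using tendsto_diff[OF limit tendsto_const[of "r\<^sup>2 / 2"]] by simp
  show "(\<lambda>k. d (b (Suc k)) (a (Suc k)) - r\<^sup>2 / 2) \<longlonglongrightarrow> 0"
    using lim0 by (rule LIMSEQ_Suc)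
qed

lemma S_nonneg: "0 \<le> S k"
  by (rule decseq_ge[OF _ S_tendsto]) (simp add: decseq_SucI S_Suc_le)

lemma breg_tendsto:
  assumes "x \<longlonglongrightarrow> p" "y \<longlonglongrightarrow> q" "\<And>n. x n \<in> A \<union> B" "\<And>n. y n \<in> A \<union> B" "p \<in> A \<union> B" "q \<in> A \<union> B"
  shows "(\<lambda>n. d (x n) (y n)) \<longlonglongrightarrow> d p q"
  using continuous_on_tendsto_compose[OF breg_continuous, of "\<lambda>n. (x n, y n)" "(p, q)" sequentially]
    assms by (auto intro: tendsto_Pair)

text \<open>Continuity of \<open>d\<close> carries minimality to the limit. The pairs are those of
  the half-steps, matching \<open>(b, a')\<close> in the two local conditions.\<close>

lemma cluster_point_gap:
  assumes s: "strict_mono s" and lim: "((\<lambda>k. (b k, a (Suc k))) \<circ> s) \<longlonglongrightarrow> (bs, as)"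
  shows "gap_pair f A B bs as" "d bs as = r\<^sup>2 / 2"
    "bs \<in> accumulation_points b" "as \<in> accumulation_points a"
proof -
  have lim_b: "(\<lambda>n. b (s n)) \<longlonglongrightarrow> bs" and lim_a: "(\<lambda>n. a (Suc (s n))) \<longlonglongrightarrow> as"
    using tendsto_fst[OF lim] tendsto_snd[OF lim] by (simp_all add: o_def)
  have "closed A" "closed B"
    using compact_A compact_B compact_imp_closed by auto
  then have in_sets: "bs \<in> B" "as \<in> A"
    using closed_sequentially[OF _ _ lim_b] closed_sequentially[OF _ _ lim_a] by auto
  have "(\<lambda>n. d (b (s n)) (a (Suc (s n)))) \<longlonglongrightarrow> d bs as"
    using lim_b lim_a in_sets by (intro breg_tendsto) auto
  moreover have "(\<lambda>n. d (b (s n)) (a (Suc (s n)))) \<longlonglongrightarrow> r\<^sup>2 / 2"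
    using tendsto_add[OF LIMSEQ_subseq_LIMSEQ[OF S_tendsto s] tendsto_const[of "r\<^sup>2 / 2"]]
    by (simp add: S_def o_def)
  ultimately show gap: "d bs as = r\<^sup>2 / 2"
    by (rule LIMSEQ_unique)
  have "as \<in> right_proj f A bs"
    unfolding right_proj_iff[OF in_sets(1)]
  proof (intro conjI ballI)
    fix x assume "x \<in> A"
    then have "(\<lambda>n. d (b (s n)) x) \<longlonglongrightarrow> d bs x"
      using lim_b in_sets by (intro breg_tendsto tendsto_const) auto
    then show "d bs as \<le> d bs x"
      using \<open>(\<lambda>n. d (b (s n)) (a (Suc (s n)))) \<longlonglongrightarrow> d bs as\<close> \<open>x \<in> A\<close>
      by (intro LIMSEQ_le) (auto simp: a_minimal)
  qed fact
  moreover have "bs \<in> left_proj f B as"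
    unfolding left_proj_iff[OF in_sets(2)]
  proof (intro conjI ballI)
    fix y assume "y \<in> B"
    then have "(\<lambda>n. d y (a (Suc (s n)))) \<longlonglongrightarrow> d y as"
      using lim_a in_sets by (intro breg_tendsto tendsto_const) auto
    \<comment> \<open>The minimiser belonging to \<open>a (Suc (s n))\<close> is
      \<open>b (Suc (s n))\<close>, which need not tend to \<open>bs\<close>. Its distance still
      tends to \<open>r\<^sup>2 / 2\<close>, the value of \<open>d bs as\<close>, and that
      suffices.\<close>
    moreover have "(\<lambda>n. d (b (Suc (s n))) (a (Suc (s n)))) \<longlonglongrightarrow> r\<^sup>2 / 2"
      using LIMSEQ_subseq_LIMSEQ[OF limit, of "Suc \<circ> s"] s by (simp add: o_def strict_mono_Suc_iff)
    ultimately show "d bs as \<le> d y as"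
      unfolding gap using \<open>y \<in> B\<close> by (intro LIMSEQ_le) (auto simp: b_minimal)
  qed fact
  ultimately show "gap_pair f A B bs as"
    using in_sets by (simp add: gap_pair_def)
  show "bs \<in> accumulation_points b"
    using lim_b s by (auto simp: accumulation_points_def o_def)
  have "strict_mono (Suc \<circ> s)"
    using s by (simp add: strict_mono_Suc_iff)
  with lim_a show "as \<in> accumulation_points a"
    unfolding accumulation_points_def by (force simp: o_def)
qed

section \<open>Controlled sets and the covering argument\<close>

text \<open>The two inequalities are asked only of steps whose pair lies in \<open>W\<close>, but
  \<open>\<Phi>\<close> must be nonnegative and nonincreasing along the whole tail. Potentials of
  different sets can therefore be added even as the sequence moves between them.\<close>

definition controlled :: "('a \<times> 'a) set \<Rightarrow> bool" where
  "controlled W \<longleftrightarrow> (\<exists>N l C \<Phi>. 0 < l \<and> 0 \<le> C \<and>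
     (\<forall>k\<ge>N. 0 \<le> \<Phi> k \<and> \<Phi> (Suc k) \<le> \<Phi> k \<and>
       ((b k, a (Suc k)) \<in> W \<longrightarrow>
         d (b k) (a (Suc k)) + l * d (a (Suc k)) (a k) \<le> d (b k) (a k) \<and>
         S k - S (Suc k) \<le> C * norm (a (Suc k) - a k) * (\<Phi> k - \<Phi> (Suc k)))))"

lemma controlled_if_avoided:
  assumes "\<forall>\<^sub>F k in sequentially. (b k, a (Suc k)) \<notin> W"
  shows "controlled W"
proof -
  obtain N where "\<And>k. N \<le> k \<Longrightarrow> (b k, a (Suc k)) \<notin> W"
    using assms by (auto simp: eventually_sequentially)
  then show ?thesis
    unfolding controlled_def by (intro exI[of _ N] exI[of _ 1] exI[of _ "\<lambda>_. 0"]) auto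
qed

lemma controlled_mono: "controlled W \<Longrightarrow> V \<subseteq> W \<Longrightarrow> controlled V"
  unfolding controlled_def by (elim ex_forward) blast

text \<open>As both potentials are nonincreasing, their sum drops at least as much as either one.
  The smaller \<open>l\<close> and the larger \<open>C\<close> serve both sets, since the factors
  they multiply are nonnegative.\<close>

lemma controlled_Un:
  assumes "controlled V" "controlled W"
  shows "controlled (V \<union> W)"
proof -
  obtain N l C \<Phi> where V: "0 < l" "0 \<le> C"
    "\<And>k. N \<le> k \<Longrightarrow> 0 \<le> \<Phi> k" "\<And>k. N \<le> k \<Longrightarrow> \<Phi> (Suc k) \<le> \<Phi> k"
    "\<And>k. N \<le> k \<Longrightarrow> (b k, a (Suc k)) \<in> V \<Longrightarrow>
      d (b k) (a (Suc k)) + l * d (a (Suc k)) (a k) \<le> d (b k) (a k)"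
    "\<And>k. N \<le> k \<Longrightarrow> (b k, a (Suc k)) \<in> V \<Longrightarrow>
      S k - S (Suc k) \<le> C * norm (a (Suc k) - a k) * (\<Phi> k - \<Phi> (Suc k))"
    using assms(1) unfolding controlled_def by metis
  obtain N' l' C' \<Phi>' where W: "0 < l'" "0 \<le> C'"
    "\<And>k. N' \<le> k \<Longrightarrow> 0 \<le> \<Phi>' k" "\<And>k. N' \<le> k \<Longrightarrow> \<Phi>' (Suc k) \<le> \<Phi>' k"
    "\<And>k. N' \<le> k \<Longrightarrow> (b k, a (Suc k)) \<in> W \<Longrightarrow>
      d (b k) (a (Suc k)) + l' * d (a (Suc k)) (a k) \<le> d (b k) (a k)"
    "\<And>k. N' \<le> k \<Longrightarrow> (b k, a (Suc k)) \<in> W \<Longrightarrow>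
      S k - S (Suc k) \<le> C' * norm (a (Suc k) - a k) * (\<Phi>' k - \<Phi>' (Suc k))"
    using assms(2) unfolding controlled_def by metis
  define \<Psi> where "\<Psi> k = \<Phi> k + \<Phi>' k" for k
  have "0 \<le> \<Psi> k \<and> \<Psi> (Suc k) \<le> \<Psi> k \<and>
       ((b k, a (Suc k)) \<in> V \<union> W \<longrightarrow>
         d (b k) (a (Suc k)) + min l l' * d (a (Suc k)) (a k) \<le> d (b k) (a k) \<and>
         S k - S (Suc k) \<le> max C C' * norm (a (Suc k) - a k) * (\<Psi> k - \<Psi> (Suc k)))"
    if k: "max N N' \<le> k" for k
  proof (intro conjI impI)
    have dec: "\<Phi> (Suc k) \<le> \<Phi> k" "\<Phi>' (Suc k) \<le> \<Phi>' k"
      using V(4) W(4) k by auto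
    show "0 \<le> \<Psi> k" "\<Psi> (Suc k) \<le> \<Psi> k"
      using V(3) W(3) k dec by (auto simp: \<Psi>_def)
    assume VW: "(b k, a (Suc k)) \<in> V \<union> W"
    have "min l l' * d (a (Suc k)) (a k) \<le> l * d (a (Suc k)) (a k)"
      "min l l' * d (a (Suc k)) (a k) \<le> l' * d (a (Suc k)) (a k)"
      by (intro mult_right_mono breg_nonneg; simp)+
    then show "d (b k) (a (Suc k)) + min l l' * d (a (Suc k)) (a k) \<le> d (b k) (a k)"
      using VW V(5)[of k] W(5)[of k] k by fastforce
    have "C * norm (a (Suc k) - a k) * (\<Phi> k - \<Phi> (Suc k))
        \<le> max C C' * norm (a (Suc k) - a k) * (\<Psi> k - \<Psi> (Suc k))"
      "C' * norm (a (Suc k) - a k) * (\<Phi>' k - \<Phi>' (Suc k))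
        \<le> max C C' * norm (a (Suc k) - a k) * (\<Psi> k - \<Psi> (Suc k))"
      using dec V(2) W(2) by (intro mult_mono mult_right_mono; auto simp: \<Psi>_def)+
    moreover have "S k - S (Suc k) \<le> C * norm (a (Suc k) - a k) * (\<Phi> k - \<Phi> (Suc k)) \<or>
        S k - S (Suc k) \<le> C' * norm (a (Suc k) - a k) * (\<Phi>' k - \<Phi>' (Suc k))"
      using VW V(6)[of k] W(6)[of k] k by auto
    ultimately show "S k - S (Suc k) \<le> max C C' * norm (a (Suc k) - a k) * (\<Psi> k - \<Psi> (Suc k))"
      by (blast intro: order_trans)
  qed
  moreover have "0 < min l l'" "0 \<le> max C C'"
    using V(1,2) W(1) by auto
  ultimately show ?thesis
    unfolding controlled_def by blast
qed

lemma controlled_if_covered: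
  assumes "\<And>p. p \<in> B \<times> A \<Longrightarrow> \<exists>W. open W \<and> p \<in> W \<and> controlled W"
  shows "controlled (B \<times> A)"
proof -
  obtain \<W> where \<W>: "\<W> \<subseteq> {W. open W \<and> controlled W}" "finite \<W>" "B \<times> A \<subseteq> \<Union>\<W>"
  proof (rule compactE[of "B \<times> A" "{W. open W \<and> controlled W}"])
    show "compact (B \<times> A)"
      by (simp add: compact_A compact_B compact_Times)
    show "B \<times> A \<subseteq> \<Union>{W. open W \<and> controlled W}"
      using assms by blast
  qed auto
  have "controlled (\<Union>\<W>)"
    using \<W>(2,1)
  proof (induction \<W>)
    case empty
    show ?case
      by (rule controlled_if_avoided) auto
  qed (auto intro: controlled_Un)
  then show ?thesis
    using \<W>(3) by (rule controlled_mono)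
qed

text \<open>Combines the decrease at index \<open>Suc k\<close> with the potential bound at index
  \<open>k\<close>: this shift is what puts \<open>x (Suc k)\<close> on the left and
  \<open>x k\<close> on the right of the recursion.\<close>

lemma convergent_if_controlled:
  assumes "controlled (B \<times> A)"
  shows "convergent a"
proof -
  obtain N l C \<Phi> where c: "0 < l" "0 \<le> C"
    "\<And>k. N \<le> k \<Longrightarrow> 0 \<le> \<Phi> k" "\<And>k. N \<le> k \<Longrightarrow> \<Phi> (Suc k) \<le> \<Phi> k"
    "\<And>k. N \<le> k \<Longrightarrow> d (b k) (a (Suc k)) + l * d (a (Suc k)) (a k) \<le> d (b k) (a k)"
    "\<And>k. N \<le> k \<Longrightarrow> S k - S (Suc k) \<le> C * norm (a (Suc k) - a k) * (\<Phi> k - \<Phi> (Suc k))"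
    using assms unfolding controlled_def by (metis SigmaI a_in b_in)
  define x where "x k = norm (a (Suc k) - a k)" for k
  have "(x (Suc k))\<^sup>2 \<le> 2 * C / (l * m) * x k * (\<Phi> k - \<Phi> (Suc k))" if k: "N \<le> k" for k
  proof -
    have "l * (m / 2 * (x (Suc k))\<^sup>2) \<le> l * d (a (Suc (Suc k))) (a (Suc k))"
      unfolding x_def using c(1) by (intro mult_left_mono breg_ge) auto
    also have "\<dots> \<le> d (b (Suc k)) (a (Suc k)) - d (b (Suc k)) (a (Suc (Suc k)))"
      using c(5)[of "Suc k"] k by simp
    \<comment> \<open>\<open>S k\<close> contains the distance before \<open>b\<close> is updated,
      which is at least the one after it.\<close>
    also have "\<dots> \<le> S k - S (Suc k)"
      using breg_step_le[of k] by (simp add: S_def)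
    also have "\<dots> \<le> C * x k * (\<Phi> k - \<Phi> (Suc k))"
      unfolding x_def by (rule c(6)[OF k])
    finally show ?thesis
      using c(1) m_pos by (simp add: field_simps)
  qed
  then have "summable x"
    using c m_pos by (intro summable_from_KL_recursion[of "2 * C / (l * m)" N x \<Phi>]) (auto simp: x_def)
  then show ?thesis
    by (intro convergent_if_summable_diffs) (simp add: x_def[abs_def])
qed

section \<open>Local control near a gap pair\<close>

text \<open>The Kurdyka-Lojasiewicz inequality along the sequence. The two shapes of
  \<open>angle_rate\<close> serve one purpose: the rate times \<open>d (b k) (a (Suc k))\<close> is
  at least a constant over the squared derivative of \<open>\<phi>\<close>.\<close>

lemma angle_condition_step:
  assumes gv: "gap_value f bs as = r" and angle: "lr_angle_condition f A B bs as"
  obtains W \<eta> \<phi> q where "open W" "(bs, as) \<in> W" "0 < \<eta>" "desingularizing \<eta> \<phi>" "0 < q"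
    "\<And>k. (b k, a (Suc k)) \<in> W \<Longrightarrow> 0 < S k \<Longrightarrow> S k < \<eta> \<Longrightarrow> q \<le> norm (a (Suc k) - a k) * deriv \<phi> (S k)"
proof -
  obtain W \<gamma> \<eta> \<phi> where W: "open W" "(bs, as) \<in> W" "0 < \<gamma>" "0 < \<eta>" and des: "desingularizing \<eta> \<phi>"
    and *: "\<And>x y z. lr_building_block f A B x y z \<Longrightarrow> (y, z) \<in> W \<Longrightarrow>
           ereal (r\<^sup>2 / 2) < right_dist f A y \<Longrightarrow> right_dist f A y < ereal (r\<^sup>2 / 2 + \<eta>) \<Longrightarrow>
           \<gamma> \<le> (1 - cos (vector_angle (gr x - gr y) (gr z - gr y)))
             / angle_rate r \<phi> (real_of_ereal (right_dist f A y) - r\<^sup>2 / 2)"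
    using angle unfolding lr_angle_condition_def gv by blast
  \<comment> \<open>The first factor is the constant of \<open>angle_step_bound\<close>. The second
    is the part of the distance that survives: at least \<open>r\<^sup>2 / 2\<close> for positive
    \<open>r\<close>, and 1 for \<open>r = 0\<close>, where the distance equals \<open>S k\<close>
    and cancels the extra factor in the rate. Taking roots, the constant delivered is
    \<open>sqrt q\<close>.\<close>
  define q where "q = 2 * m\<^sup>2 * \<gamma> / L ^ 3 * (if 0 < r then r\<^sup>2 / 2 else 1)"
  have q: "0 < q"
    using W(3) L_pos m_pos by (simp add: q_def)
  have "sqrt q \<le> norm (a (Suc k) - a k) * deriv \<phi> (S k)"
    if k: "(b k, a (Suc k)) \<in> W" "0 < S k" "S k < \<eta>" for k
  proof -
    let ?x = "norm (a (Suc k) - a k)" and ?D = "deriv \<phi> (S k)"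
    have D: "0 < ?D"
      using des k by (simp add: desingularizing_def)
    then have rate: "0 < angle_rate r \<phi> (S k)"
      using k by (simp add: angle_rate_def)
    have rd: "right_dist f A (b k) = ereal (S k + r\<^sup>2 / 2)"
      using right_dist_eq[OF b_in a_right_proj] by (simp add: S_def)
    have "2 * m\<^sup>2 * \<gamma> / L ^ 3 * (angle_rate r \<phi> (S k) * d (b k) (a (Suc k))) \<le> ?x\<^sup>2"
      using *[OF building_block k(1)] k W(3) rate
      by (intro angle_step_bound) (auto simp: rd a_minimal)
    moreover have "(if 0 < r then r\<^sup>2 / 2 else 1) / ?D\<^sup>2 \<le> angle_rate r \<phi> (S k) * d (b k) (a (Suc k))"
    proof (cases "0 < r")
      case True
      moreover have "r\<^sup>2 / 2 / ?D\<^sup>2 \<le> d (b k) (a (Suc k)) / ?D\<^sup>2"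
        using k(2) by (intro divide_right_mono) (auto simp: S_def)
      ultimately show ?thesis
        by (simp add: angle_rate_def)
    next
      case False
      then have "d (b k) (a (Suc k)) = S k"
        unfolding S_def using r_nonneg by simp
      then show ?thesis
        using False k by (simp add: angle_rate_def)
    qed
    moreover have "0 \<le> 2 * m\<^sup>2 * \<gamma> / L ^ 3"
      using W(3) L_pos by simp
    ultimately have "2 * m\<^sup>2 * \<gamma> / L ^ 3 * ((if 0 < r then r\<^sup>2 / 2 else 1) / ?D\<^sup>2) \<le> ?x\<^sup>2"
      by (blast intro: order_trans mult_left_mono)
    then have "q / ?D\<^sup>2 \<le> ?x\<^sup>2"
      by (simp only: q_def times_divide_eq_right)
    then have "(sqrt q)\<^sup>2 \<le> (?x * ?D)\<^sup>2"
      using D q by (simp add: divide_le_eq power_mult_distrib)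
    then show ?thesis
      using D by (intro power2_le_imp_le[of "sqrt q"]) auto
  qed
  with q show ?thesis
    by (intro that[of W \<eta> \<phi> "sqrt q"] W des) auto
qed

text \<open>The potential is \<open>\<phi> (S k)\<close>. Multiplying the inequality of
  \<open>angle_condition_step\<close> by \<open>S k - S (Suc k)\<close> and applying the tangent
  bound at \<open>S k\<close> gives the estimate with constant \<open>1 / q\<close>.\<close>

lemma controlled_near_gap_pair:
  assumes gv: "gap_value f bs as = r"
    and angle: "lr_angle_condition f A B bs as" and three: "lr_three_point f A B bs as"
  shows "\<exists>W. open W \<and> (bs, as) \<in> W \<and> controlled W"
proof -
  obtain W \<eta> \<phi> q where W: "open W" "(bs, as) \<in> W" and \<eta>: "0 < \<eta>" and des: "desingularizing \<eta> \<phi>"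
    and q: "0 < q"
    and step: "\<And>k. (b k, a (Suc k)) \<in> W \<Longrightarrow> 0 < S k \<Longrightarrow> S k < \<eta> \<Longrightarrow>
      q \<le> norm (a (Suc k) - a k) * deriv \<phi> (S k)"
    using angle_condition_step[OF gv angle] by blast
  obtain l \<delta> where l: "0 < l" "0 < \<delta>"
    and l3: "\<And>x y z. lr_building_block f A B x y z \<Longrightarrow> norm (y - bs) < \<delta> \<Longrightarrow> norm (z - as) < \<delta> \<Longrightarrow>
      bregman f y z + ereal l * bregman f z x \<le> bregman f y x"
    using three unfolding lr_three_point_def by blast
  have l3': "d (b k) (a (Suc k)) + l * d (a (Suc k)) (a k) \<le> d (b k) (a k)"
    if "norm (b k - bs) < \<delta>" "norm (a (Suc k) - as) < \<delta>" for k
    using l3[OF building_block that] by (simp add: bregman_eq)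
  obtain N where N: "\<And>k. N \<le> k \<Longrightarrow> S k < \<eta>"
    using order_tendstoD(2)[OF S_tendsto \<eta>] by (auto simp: eventually_sequentially)
  have desc: "S k - S (Suc k) \<le> 1 / q * norm (a (Suc k) - a k) * (\<phi> (S k) - \<phi> (S (Suc k)))"
    if "N \<le> k" "(b k, a (Suc k)) \<in> W" for k
  \<comment> \<open>The angle condition requires a strictly positive excess. Once the excess is zero
    it stays zero, and both sides vanish.\<close>
  proof (cases "S k = 0")
    case True
    then have "S (Suc k) = 0"
      using S_Suc_le[of k] S_nonneg[of "Suc k"] by simp
    with True show ?thesis
      by simp
  next
    case False
    then have Sk: "0 < S k" "S k < \<eta>"
      using S_nonneg[of k] N that(1) by (auto simp: less_le)
    have "q * (S k - S (Suc k)) \<le> norm (a (Suc k) - a k) * deriv \<phi> (S k) * (S k - S (Suc k))"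
      using step[OF that(2) Sk] S_Suc_le[of k] by (intro mult_right_mono) auto
    also have "\<dots> \<le> norm (a (Suc k) - a k) * (\<phi> (S k) - \<phi> (S (Suc k)))"
      using desingularizing_tangent[OF des Sk S_nonneg, of "Suc k"] N[of "Suc k"] that(1)
      by (simp add: mult.assoc mult_left_mono)
    finally show ?thesis
      using q by (simp add: field_simps)
  qed
  \<comment> \<open>Shrinking to balls of radius \<open>\<delta>\<close> makes the three-point
    inequality available together with the angle condition.\<close>
  let ?W = "W \<inter> (ball bs \<delta> \<times> ball as \<delta>)"
  have "controlled ?W"
    unfolding controlled_def
  proof (intro exI conjI allI impI)
    fix k assume k: "N \<le> k"
    show "0 \<le> \<phi> (S k)"
      using des N[OF k] S_nonneg[of k] by (simp add: desingularizing_def)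
    show "\<phi> (S (Suc k)) \<le> \<phi> (S k)"
      using des S_nonneg S_Suc_le N[OF k] by (rule desingularizing_mono)
    assume z: "(b k, a (Suc k)) \<in> ?W"
    then show "d (b k) (a (Suc k)) + l * d (a (Suc k)) (a k) \<le> d (b k) (a k)"
      by (intro l3') (auto simp: dist_norm norm_minus_commute)
    show "S k - S (Suc k) \<le> 1 / q * norm (a (Suc k) - a k) * (\<phi> (S k) - \<phi> (S (Suc k)))"
      using k z by (intro desc) auto
  qed (use l q in auto)
  moreover have "open ?W" "(bs, as) \<in> ?W"
    using W l by (auto intro: open_Int open_Times)
  ultimately show ?thesis
    by blast
qed

text \<open>Each point of the compact product \<open>B \<times> A\<close> is either a cluster point
  of the half-step pairs, hence a gap pair of accumulation points with value \<open>r\<close>, or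
  has a neighbourhood that the tail avoids. Both kinds have controlled neighbourhoods.\<close>

theorem convergent_alternation:
  assumes "\<And>bs as. gap_pair f A B bs as \<Longrightarrow> bs \<in> accumulation_points b \<Longrightarrow>
      as \<in> accumulation_points a \<Longrightarrow> lr_angle_condition f A B bs as \<and> lr_three_point f A B bs as"
  shows "convergent a"
proof (intro convergent_if_controlled controlled_if_covered)
  fix p assume "p \<in> B \<times> A"
  then obtain bs as where p: "p = (bs, as)" "bs \<in> B" "as \<in> A"
    by blast
  show "\<exists>W. open W \<and> p \<in> W \<and> controlled W"
  proof (rule cluster_point_or_avoiding_nhd[of "\<lambda>k. (b k, a (Suc k))" p])
    fix s assume s: "strict_mono s" "((\<lambda>k. (b k, a (Suc k))) \<circ> s) \<longlonglongrightarrow> p"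
    note gap = cluster_point_gap[OF s(1) s(2)[unfolded p(1)]]
    have "gap_value f bs as = r"
      using gap(2) p r_nonneg by (intro gap_value_eqI) (auto simp: bregman_eq)
    then show ?thesis
      using gap assms p(1) controlled_near_gap_pair by blast
  qed (use controlled_if_avoided in blast)
qed

end

section \<open>Establishing the abstract setting for a Legendre function\<close>

theorem theorem8p1:
  fixes f :: "real ^ 'n::finite \<Rightarrow> ereal"
    and A B :: "(real ^ 'n) set"
    and a b :: "nat \<Rightarrow> real ^ 'n"
    and K :: "((real ^ 'n) \<times> (real ^ 'n)) set"
    and r :: real
  assumes "convex_ext f"
    and "legendre_type f"
    and "C2_on (int_dom f) (real_part f)"
    and "\<And>x. x \<in> int_dom f \<Longrightarrow> pos_definite (hessian (real_part f) x)"
    and "A \<noteq> {}" and "closed A" and "bounded A" and "A \<subseteq> int_dom f"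
    and "B \<noteq> {}" and "closed B" and "bounded B" and "B \<subseteq> int_dom f"
    and "bregman_alternating f A B a b"
    and "sequence_gap f A B a b K r"
    and "\<And>bs as. (bs, as) \<in> K \<Longrightarrow> lr_angle_condition f A B bs as"
    and "\<And>bs as. (bs, as) \<in> K \<Longrightarrow> lr_three_point f A B bs as"
  shows "(\<forall>k. a (Suc k) \<in> (\<Union>b'\<in>left_proj f B (a k). right_proj f A b')) \<and> convergent a"
proof (intro conjI allI)
  let ?g = "real_part f"
  have alt: "b k \<in> left_proj f B (a k)" "a (Suc k) \<in> right_proj f A (b k)" for k
    using assms(13) by (auto simp: bregman_alternating_def)
  then show "a (Suc k) \<in> (\<Union>b'\<in>left_proj f B (a k). right_proj f A b')" for k
    by blast
  \<comment> \<open>The gradient estimates integrate along segments, so they are made on the convex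
    hull. It is compact in finite dimension and stays inside the convex set
    \<open>int_dom f\<close>.\<close>
  define Q where "Q = convex hull (A \<union> B)"
  have "compact A" "compact B"
    using assms(6,7,10,11) by (auto simp: compact_eq_bounded_closed)
  then have Q: "compact Q" "convex Q"
    by (simp_all add: Q_def compact_convex_hull compact_Un)
  have AB: "x \<in> Q" "x \<in> int_dom f" if "x \<in> A \<union> B" for x
    using that assms(8,12) by (auto simp: Q_def hull_inc)
  have "convex (int_dom f)"
    using assms(2) by (simp add: legendre_type_def strictly_convex_on_def)
  then have sub: "Q \<subseteq> int_dom f"
    unfolding Q_def using assms(8,12) by (intro hull_minimal) auto
  obtain L where L: "0 < L"
    "\<And>x y. x \<in> Q \<Longrightarrow> y \<in> Q \<Longrightarrow> norm (grad ?g x - grad ?g y) \<le> L * norm (x - y)"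
    using C2_grad_Lipschitz_on_compact[OF assms(3) Q sub] by blast
  obtain m where m: "0 < m" "\<And>x v. x \<in> Q \<Longrightarrow> m * (norm v)\<^sup>2 \<le> v \<bullet> (hessian ?g x *v v)"
    using hessian_uniformly_positive_on_compact[OF assms(3,4) Q(1) sub] by blast
  note mono = C2_grad_strongly_monotone[OF assms(3) Q(2) sub m(2)]
  have diff: "?g differentiable (at x)" if "x \<in> Q" for x
    using assms(3) that sub by (auto simp: C2_on_def)
  have eq: "bregman f x y = ereal (breg ?g x y)" if "x \<in> A \<union> B" "y \<in> A \<union> B" for x y
    using assms(1) AB that by (intro bregman_eq_breg) (auto simp: convex_ext_def)
  have gap: "0 \<le> r" "(\<lambda>k. bregman f (b k) (a k)) \<longlonglongrightarrow> ereal (r\<^sup>2 / 2)"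
    using assms(14) by (auto simp: sequence_gap_def)
  have "a k \<in> A" "b k \<in> B" for k
    using assms(13) by (auto simp: bregman_alternating_def)
  then have lim: "(\<lambda>k. breg ?g (b k) (a k)) \<longlonglongrightarrow> r\<^sup>2 / 2"
    using gap(2) by (simp add: eq)
  interpret bregman_alternation f A B a b r L m
  proof
    show "m / 2 * (norm (x - y))\<^sup>2 \<le> breg ?g x y" if "x \<in> A \<union> B" "y \<in> A \<union> B" for x y
      using breg_ge_of_strongly_monotone[OF diff Q(2) mono] AB that by blast
    show "continuous_on ((A \<union> B) \<times> (A \<union> B)) (\<lambda>p. breg ?g (fst p) (snd p))"
      using AB(2) by (intro continuous_on_subset[OF continuous_on_breg[OF assms(3)]]) auto
  qed (use eq L m(1) mono AB(1) lim gap(1) assms(13) \<open>compact A\<close> \<open>compact B\<close> in blast)+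
  \<comment> \<open>\<open>K\<close> consists of exactly the gap pairs of accumulation points, so
    the assumptions on \<open>K\<close> are those of \<open>convergent_alternation\<close>.\<close>
  show "convergent a"
    using assms(14-16) by (intro convergent_alternation) (auto simp: sequence_gap_def)
qed

end
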